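(* Let $D$ be a squarefree positive integer, $\mathbb{I}=\mathbb{Q}(\sqrt{-D})$ and $\mathbb{Z}_{\mathbb{I}}$ its ring of integers. Let $$L_m(\overline z)=\sum_{n=1}^Na_{mn}z_n,\qquad m=1,\dots,M,$$ be $M$ non-trivial (not identically zero) linear forms with coefficients $a_{mn}\in\mathbb{Z}_{\mathbb{I}}$ in $N$ variables $z_n$, where $M<N$, and put $A_m=\sum_{n=1}^N|a_{mn}|$ for $m=1,\dots,M$. Then the system of equations $L_m(\overline z)=0$, $m=1,\dots,M$, has a solution $\overline z=(z_1,\dots,z_N)^T\in\mathbb{Z}_{\mathbb{I}}^N\setminus\{\overline0\}$ with $$1\le\max_{1\le n\le N}|z_n|\le\max\left\{2c\sqrt D,\ s_{\mathbb{I}}\,t_{\mathbb{I}}^{\frac{M}{N-M}}(A_1\cdots A_M)^{\frac1{N-M}}\right\},$$ where $t_{\mathbb{I}}=\frac{5}{2\sqrt2}$ and $$s_{\mathbb{I}}=\frac{2\sqrt2\,D^{1/4}}{\sqrt\pi},\quad c=2\sqrt2\quad\text{if }D\equiv1,2\pmod4;\qquad s_{\mathbb{I}}=\frac{2}{\sqrt\pi}D^{1/4},\quad c=2\quad\text{if }D\equiv3\pmod4 .$$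
   Context: $|\cdot|$ is the usual complex absolute value. *)

theory Defs
  imports Complex_Main "HOL-Computational_Algebra.Computational_Algebra"
begin

definition imag_quad_field :: "nat \<Rightarrow> complex set" where
  "imag_quad_field D = {of_rat x + of_rat y * csqrt (- of_nat D) | x y. True}"

definition ring_of_ints :: "complex set \<Rightarrow> complex set" where
  "ring_of_ints K = {z \<in> K. algebraic_int z}"

text \<open>Vectors of length \<open>N\<close> are functions on \<open>nat\<close> of which only the values on
  \<open>{1..N}\<close> matter.\<close>

definition linear_form :: "nat \<Rightarrow> (nat \<Rightarrow> complex) \<Rightarrow> (nat \<Rightarrow> complex) \<Rightarrow> complex" where
  "linear_form N c z = (\<Sum>n=1..N. c n * z n)"

definition coeff_norm :: "nat \<Rightarrow> (nat \<Rightarrow> complex) \<Rightarrow> real" where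
  "coeff_norm N c = (\<Sum>n=1..N. cmod (c n))"

text \<open>The constants below are meant for squarefree \<open>D\<close>, so that \<open>D\<close> is not divisible by 4
  and the last branch is the case \<open>D mod 4 = 3\<close>.\<close>

definition s_const :: "nat \<Rightarrow> real" where
  "s_const D =
     (if D mod 4 = 1 \<or> D mod 4 = 2 then 2 * sqrt 2 * real D powr (1/4) / sqrt pi
      else 2 / sqrt pi * real D powr (1/4))"

definition c_const :: "nat \<Rightarrow> real" where
  "c_const D = (if D mod 4 = 1 \<or> D mod 4 = 2 then 2 * sqrt 2 else 2)"

definition t_const :: real where
  "t_const = 5 / (2 * sqrt 2)"

end

theory Submission
  imports Defs "HOL-Analysis.Ball_Volume"
begin

text \<open>
  The ring of integers is a planar lattice tiled by rectangles of size \<open>1 \<times> h\<close> centred at its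
  points, with \<open>h = \<surd>D\<close> or \<open>h = \<surd>D/2\<close>. Comparing areas, a disc of radius \<open>R\<close> contains at
  least \<open>\<pi>(R - d)\<^sup>2/h\<close> and at most \<open>\<pi>(R + d)\<^sup>2/h\<close> lattice points, where \<open>d\<close> is half the diagonal
  of a tile. If all radii are at least \<open>4d\<close>, the two bounds are off from \<open>\<pi>R\<^sup>2/h\<close> by factors better
  than \<open>1/2\<close> and \<open>25/16\<close>. If \<open>X\<close> denotes the claimed bound, there are thus more \<open>N\<close>-tuples
  of lattice points in the disc of radius \<open>X/2\<close> than possible values of the system on them (the
  \<open>m\<close>-th value lies in the disc of radius \<open>A\<^sub>m X/2\<close>), and two tuples with the same values differ by
  the required solution.
\<close>

subsection \<open>Quadratic algebraic integers\<close>

lemma map_poly_of_int_mult: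
  "map_poly (of_int :: int \<Rightarrow> 'a :: comm_ring_1) (p * q) = map_poly of_int p * map_poly of_int q"
  by (intro poly_eqI) (simp add: coeff_map_poly coeff_mult)

lemma map_poly_of_int_add:
  "map_poly (of_int :: int \<Rightarrow> 'a :: comm_ring_1) (p + q) = map_poly of_int p + map_poly of_int q"
  by (intro poly_eqI) (simp add: coeff_map_poly)

lemma map_poly_of_int_smult:
  "map_poly (of_int :: int \<Rightarrow> 'a :: comm_ring_1) (smult c p) = smult (of_int c) (map_poly of_int p)"
  by (intro poly_eqI) (simp add: coeff_map_poly)

text \<open>
  Gauss's lemma in disguise: dividing a monic integer polynomial with root \<open>z\<close> by \<open>Q\<close> leaves a
  remainder of degree at most 1 vanishing at the non-real \<open>z\<close>, so \<open>Q\<close> divides it up to a constant.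
\<close>
lemma primitive_quadratic_lead_coeff_unit:
  fixes Q :: "int poly" and z :: complex
  assumes Q: "Polynomial.content Q = 1" "degree Q = 2" "poly (map_poly of_int Q) z = 0"
    and z: "algebraic_int z" "Im z \<noteq> 0"
  shows "lead_coeff Q dvd 1"
proof -
  obtain P :: "int poly" where P: "poly (map_poly of_int P) z = 0" "lead_coeff P = 1"
    using z(1) algebraic_int_altdef_ipoly by blast
  obtain S R where SR: "pseudo_divmod P Q = (S, R)" by (cases "pseudo_divmod P Q")
  define c where "c = coeff Q (degree Q) ^ (Suc (degree P) - degree Q)"
  have "Q \<noteq> 0" using Q(2) by auto
  from pseudo_divmod[OF this SR] have eq: "smult c P = Q * S + R" and R: "R = 0 \<or> degree R < 2"
    using Q(2) by (auto simp: c_def)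
  have "poly (map_poly of_int (smult c P)) z = 0"
    using P(1) by (simp add: map_poly_of_int_mult map_poly_of_int_add map_poly_of_int_smult)
  hence Rz: "poly (map_poly of_int R) z = 0"
    unfolding eq using Q(3) by (simp add: map_poly_of_int_mult map_poly_of_int_add map_poly_of_int_smult)
  have "R = 0"
  proof -
    have R2: "R = [:coeff R 0, coeff R 1:]"
      using R by (intro poly_eqI) (auto simp: coeff_pCons coeff_eq_0 split: nat.splits)
    have "of_int (coeff R 0) + z * of_int (coeff R 1) = 0"
      using Rz by (subst (asm) R2) (simp add: map_poly_pCons)
    hence "Im z * of_int (coeff R 1) = 0 \<and> of_int (coeff R 0) + Re z * of_int (coeff R 1) = 0"
      by (auto simp: complex_eq_iff)
    thus ?thesis using z(2) R2 by auto
  qed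
  with eq have eq: "smult c P = Q * S" by simp
  \<comment> \<open>Contents are compared in \<open>c P = Q S\<close>: the monic \<open>P\<close>
    and the primitive \<open>Q\<close> have content 1, so \<open>c\<close> divides \<open>S\<close>
    and cancels, which leaves a factorization of \<open>P\<close> over the integers. The leading
    coefficient of \<open>Q\<close> then divides 1.\<close>
  have "Polynomial.content P = 1"
    using content_dvd_coeff[of P "degree P"] P(2) by (metis is_unit_content_iff)
  hence "Polynomial.content S = normalize c"
    using arg_cong[OF eq, of Polynomial.content] Q(1) by (simp add: content_mult content_smult)
  hence "c dvd Polynomial.content S" by simp
  hence "[:c:] dvd S" by (simp only: const_poly_dvd_iff_dvd_content)
  then obtain S' where S: "S = smult c S'" by auto
  have "c \<noteq> 0" using \<open>Q \<noteq> 0\<close> by (auto simp: c_def)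
  hence "P = Q * S'" using eq S by (metis mult_smult_right smult_cancel)
  thus ?thesis using P(2) by (metis dvd_triv_left lead_coeff_mult)
qed

text \<open>A non-real \<open>z\<close> is a root of \<open>X^2 - 2 Re z X + |z|^2\<close>. Clearing
  denominators and passing to the primitive part gives an integer quadratic whose leading
  coefficient must be a unit, so trace and norm are quotients of integers by 1 or -1.\<close>

lemma quadratic_algebraic_int_trace_norm:
  fixes z :: complex
  assumes z: "algebraic_int z" and rat: "2 * Re z \<in> \<rat>" "(cmod z)\<^sup>2 \<in> \<rat>" and im: "Im z \<noteq> 0"
  shows "2 * Re z \<in> \<int>" "(cmod z)\<^sup>2 \<in> \<int>"
proof -
  obtain u1 e1 :: int where 1: "2 * Re z = of_int u1 / of_int e1" "e1 > 0"
    using rat(1) by (elim Rats_cases') auto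
  obtain u2 e2 :: int where 2: "(cmod z)\<^sup>2 = of_int u2 / of_int e2" "e2 > 0"
    using rat(2) by (elim Rats_cases') auto
  define Q0 where "Q0 = [:u2 * e1, - (u1 * e2), e1 * e2:]"
  define Q where "Q = primitive_part Q0"
  define c where "c = Polynomial.content Q0"
  have deg0: "degree Q0 = 2" using 1 2 by (simp add: Q0_def)
  hence "Q0 \<noteq> 0" by auto
  hence c: "c \<noteq> 0" and Qc: "Polynomial.content Q = 1" by (auto simp: c_def Q_def)
  have Q0: "Q0 = smult c Q" by (simp add: c_def Q_def)
  have deg: "degree Q = 2" using deg0 by (simp add: Q_def)
  have cf: "c * coeff Q 0 = u2 * e1" "c * coeff Q 1 = - (u1 * e2)" "c * coeff Q 2 = e1 * e2"
    using arg_cong[OF Q0, of "\<lambda>p. coeff p 0"] arg_cong[OF Q0, of "\<lambda>p. coeff p 1"]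
      arg_cong[OF Q0, of "\<lambda>p. coeff p 2"] by (auto simp: Q0_def numeral_2_eq_2)
  have "z * z - of_real (2 * Re z) * z + of_real ((cmod z)\<^sup>2) = 0"
    by (simp add: complex_eq_iff cmod_power2) (simp add: power2_eq_square algebra_simps)
  hence "of_int (e1 * e2) * (z * z) - of_int (u1 * e2) * z + of_int (u2 * e1) = 0"
    using 1 2 unfolding 1(1) 2(1) by (simp add: field_simps)
  hence "poly (map_poly of_int Q0) z = 0"
    by (simp add: Q0_def map_poly_pCons algebra_simps)
  hence "poly (map_poly of_int Q) z = 0"
    unfolding Q0 using c by (simp add: map_poly_of_int_mult map_poly_of_int_add map_poly_of_int_smult)
  from primitive_quadratic_lead_coeff_unit[OF Qc deg this z im]
  have un: "coeff Q 2 = 1 \<or> coeff Q 2 = -1" unfolding deg by auto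
  \<comment> \<open>Ratios of coefficients are the same for \<open>Q0\<close> and its primitive
    part, since \<open>c\<close> cancels.\<close>
  have "2 * Re z = - of_int (c * coeff Q 1) / of_int (c * coeff Q 2)"
       "(cmod z)\<^sup>2 = of_int (c * coeff Q 0) / of_int (c * coeff Q 2)"
    unfolding cf using 1 2 by simp_all
  thus "2 * Re z \<in> \<int>" "(cmod z)\<^sup>2 \<in> \<int>" using un c by auto
qed

text \<open>With \<open>y = u / v\<close> in lowest terms, \<open>v^2\<close> divides
  \<open>D u^2\<close> and is coprime to \<open>u^2\<close>, so it divides the squarefree
  \<open>D\<close>.\<close>

lemma squarefree_mult_rat_square_int:
  fixes y :: rat
  assumes D: "squarefree D" and int: "of_nat D * y\<^sup>2 \<in> \<int>"
  shows "y \<in> \<int>"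
proof -
  obtain u v where uv: "quotient_of y = (u, v)" by (cases "quotient_of y")
  have cop: "coprime u v" and v: "v > 0" and y: "y = of_int u / of_int v"
    using quotient_of_coprime[OF uv] quotient_of_denom_pos[OF uv] quotient_of_div[OF uv] by auto
  obtain w where w: "of_nat D * y\<^sup>2 = of_int w" using int by (elim Ints_cases)
  have "(of_int (int D * u\<^sup>2) :: rat) = of_int (w * v\<^sup>2)"
    using w v by (simp add: y field_simps)
  hence "int D * u\<^sup>2 = w * v\<^sup>2" by (simp only: of_int_eq_iff)
  hence "v\<^sup>2 dvd int D * u\<^sup>2" by simp
  hence "v\<^sup>2 dvd int D" using cop by (simp add: coprime_commute coprime_dvd_mult_left_iff)
  hence "int ((nat v)\<^sup>2) dvd int D" using v by simp
  hence "(nat v)\<^sup>2 dvd D" by (simp only: int_dvd_int_iff)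
  hence "nat v dvd 1" using D by (auto dest: squarefreeD)
  hence "v = 1" using v by simp
  thus ?thesis using y by simp
qed

lemma csqrt_minus_of_nat: "csqrt (- of_nat D) = \<i> * of_real (sqrt (real D))"
  by (simp add: csqrt_of_real_nonpos[of "- real D", simplified])

text \<open>Squares are 0 or 1 modulo 4, which leaves four combinations of parities to check for
  each residue of \<open>D\<close>.\<close>

lemma four_dvd_sum_squares_parity:
  fixes p q :: int
  assumes "4 dvd p\<^sup>2 + int D * q\<^sup>2"
  shows "D mod 4 = 1 \<or> D mod 4 = 2 \<Longrightarrow> even p \<and> even q" and "D mod 4 = 3 \<Longrightarrow> even (p - q)"
proof -
  have sq: "x\<^sup>2 mod 4 = (if even x then 0 else 1)" for x :: int
  proof (cases "even x")
    case True
    then obtain k where "x = 2 * k" by (elim evenE)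
    hence "x\<^sup>2 = 4 * k\<^sup>2" by (simp add: power2_eq_square)
    thus ?thesis using True by simp
  next
    case False
    then obtain k where "x = 2 * k + 1" by (elim oddE)
    hence "x\<^sup>2 = 1 + 4 * (k\<^sup>2 + k)" by (simp add: power2_eq_square algebra_simps)
    hence "x\<^sup>2 mod 4 = 1" by (simp only: mod_mult_self2) simp
    thus ?thesis using False by simp
  qed
  have "(p\<^sup>2 mod 4 + (int D mod 4) * (q\<^sup>2 mod 4)) mod 4 = (p\<^sup>2 + int D * q\<^sup>2) mod 4"
    by (rule mod_add_cong) (auto simp: mod_mult_eq)
  also have "\<dots> = 0" using assms by (rule dvd_imp_mod_0)
  finally have "0 = (p\<^sup>2 mod 4 + (int D mod 4) * (q\<^sup>2 mod 4)) mod 4" by (rule sym)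
  hence *: "0 = ((if even p then 0 else 1) + int (D mod 4) * (if even q then 0 else 1)) mod 4"
    unfolding sq by (simp add: zmod_int)
  show "even p \<and> even q" if "D mod 4 = 1 \<or> D mod 4 = 2"
    using * that by (auto split: if_splits)
  show "even (p - q)" if "D mod 4 = 3"
    using * that by (auto split: if_splits)
qed

subsection \<open>Planar lattices of quadratic integers\<close>

text \<open>
  The order \<open>\<int>[\<omega>]\<close> for a non-real root \<open>\<omega>\<close> of \<open>X\<^sup>2 - T X + n\<close>.
\<close>
locale quadratic_lattice =
  fixes T n :: int
  assumes disc: "T\<^sup>2 < 4 * n"
begin

text \<open>Half the square root of \<open>4 * n - T^2\<close>, minus the discriminant. It is the
  imaginary part of the root \<open>\<omega>\<close>, hence the distance between consecutive
  horizontal rows of the lattice, and the area of a tile.\<close>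

definition h :: real where "h = sqrt (of_int n - (of_int T)\<^sup>2 / 4)"
definition \<omega> :: complex where "\<omega> = Complex (of_int T / 2) h"
definition \<Lambda> :: "complex set" where "\<Lambda> = {of_int j + of_int k * \<omega> | j k. True}"
definition points :: "real \<Rightarrow> complex set" where "points R = {z \<in> \<Lambda>. cmod z \<le> R}"
definition d :: real where "d = sqrt (1 + h\<^sup>2) / 2"

lemma h_sq: "h\<^sup>2 = of_int n - (of_int T)\<^sup>2 / 4" and h_pos: "h > 0"
proof -
  have "of_int (T\<^sup>2) < (of_int (4 * n) :: real)" using disc by (simp only: of_int_less_iff)
  thus "h\<^sup>2 = of_int n - (of_int T)\<^sup>2 / 4" "h > 0" by (auto simp: h_def)
qed

lemma lattice_memI: "z = of_int j + of_int k * \<omega> \<Longrightarrow> z \<in> \<Lambda>"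
  by (auto simp: \<Lambda>_def)

lemma omega_sq: "\<omega> * \<omega> = of_int T * \<omega> - of_int n"
  using h_sq by (auto simp: \<omega>_def complex_eq_iff power2_eq_square)

text \<open>The norm form of the order. That it is integer-valued gives both the lower bound 1 for
  nonzero elements and the integrality of all elements.\<close>

lemma cmod_lattice_sq:
  "(cmod (of_int j + of_int k * \<omega>))\<^sup>2 = of_int (j\<^sup>2 + T * j * k + n * k\<^sup>2)"
proof -
  have "(cmod (of_int j + of_int k * \<omega>))\<^sup>2 = (of_int j + of_int k * of_int T / 2)\<^sup>2 + (of_int k)\<^sup>2 * h\<^sup>2"
    by (simp add: cmod_power2 \<omega>_def power_mult_distrib)
  also have "\<dots> = of_int (j\<^sup>2 + T * j * k + n * k\<^sup>2)"
    unfolding h_sq by (simp add: power2_eq_square algebra_simps)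
  finally show ?thesis .
qed

lemma lattice_0: "0 \<in> \<Lambda>" by (rule lattice_memI[of _ 0 0]) simp

lemma lattice_add: assumes "x \<in> \<Lambda>" "y \<in> \<Lambda>" shows "x + y \<in> \<Lambda>"
proof -
  obtain a b c e where "x = of_int a + of_int b * \<omega>" "y = of_int c + of_int e * \<omega>"
    using assms by (auto simp: \<Lambda>_def)
  thus ?thesis by (intro lattice_memI[of _ "a + c" "b + e"]) (simp add: algebra_simps)
qed

lemma lattice_diff: assumes "x \<in> \<Lambda>" "y \<in> \<Lambda>" shows "x - y \<in> \<Lambda>"
proof -
  obtain a b c e where "x = of_int a + of_int b * \<omega>" "y = of_int c + of_int e * \<omega>"
    using assms by (auto simp: \<Lambda>_def)
  thus ?thesis by (intro lattice_memI[of _ "a - c" "b - e"]) (simp add: algebra_simps)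
qed

lemma lattice_mult: assumes "x \<in> \<Lambda>" "y \<in> \<Lambda>" shows "x * y \<in> \<Lambda>"
proof -
  obtain a b c e where xy: "x = of_int a + of_int b * \<omega>" "y = of_int c + of_int e * \<omega>"
    using assms by (auto simp: \<Lambda>_def)
  have "x * y = of_int (a * c) + of_int (a * e + b * c) * \<omega> + of_int (b * e) * (\<omega> * \<omega>)"
    by (simp add: xy algebra_simps)
  also have "\<dots> = of_int (a * c - b * e * n) + of_int (a * e + b * c + b * e * T) * \<omega>"
    unfolding omega_sq by (simp add: algebra_simps)
  finally show ?thesis by (rule lattice_memI)
qed

lemma lattice_sum: "(\<And>i. i \<in> I \<Longrightarrow> f i \<in> \<Lambda>) \<Longrightarrow> sum f I \<in> \<Lambda>"
  by (induction I rule: infinite_finite_induct) (auto intro: lattice_0 lattice_add)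

lemma lattice_cmod_ge_1:
  assumes "z \<in> \<Lambda>" "z \<noteq> 0"
  shows "1 \<le> cmod z"
proof -
  obtain j k where z: "z = of_int j + of_int k * \<omega>" using assms by (auto simp: \<Lambda>_def)
  define m where "m = j\<^sup>2 + T * j * k + n * k\<^sup>2"
  have m: "(cmod z)\<^sup>2 = of_int m" by (simp only: z cmod_lattice_sq m_def)
  moreover have "(cmod z)\<^sup>2 > 0" using assms(2) by simp
  ultimately have "m \<ge> 1" by simp
  hence "(cmod z)\<^sup>2 \<ge> 1" unfolding m by simp
  thus ?thesis by (metis norm_ge_zero one_power2 power2_le_imp_le)
qed

text \<open>The polynomial \<open>X^2 - 2 Re z X + |z|^2\<close> is monic with root
  \<open>z\<close>, and its coefficients are integers on the lattice.\<close>

lemma lattice_algebraic_int: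
  assumes "z \<in> \<Lambda>"
  shows "algebraic_int z"
proof -
  obtain j k where z: "z = of_int j + of_int k * \<omega>" using assms by (auto simp: \<Lambda>_def)
  define m where "m = j\<^sup>2 + T * j * k + n * k\<^sup>2"
  define p where "p = [:m, - (2 * j + T * k), 1:]"
  have re: "2 * Re z = of_int (2 * j + T * k)" by (simp add: z \<omega>_def)
  have m: "(cmod z)\<^sup>2 = of_int m" by (simp only: z cmod_lattice_sq m_def)
  have "z * z - of_real (2 * Re z) * z + of_real ((cmod z)\<^sup>2) = 0"
    by (simp add: complex_eq_iff cmod_power2) (simp add: power2_eq_square algebra_simps)
  hence "z * z - of_int (2 * j + T * k) * z + of_int m = 0" unfolding re m by simp
  hence "poly (map_poly of_int p) z = 0"
    by (simp add: p_def map_poly_pCons algebra_simps)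
  moreover have "lead_coeff p = 1" by (simp add: p_def)
  ultimately show ?thesis unfolding algebraic_int_altdef_ipoly by blast
qed

text \<open>The imaginary part bounds \<open>k\<close> by \<open>|R| / h\<close>; given this, the
  real part bounds \<open>j\<close>. The constant \<open>B\<close> is a crude common bound for both
  coordinates.\<close>

lemma finite_points: "finite (points R)"
proof -
  define B where "B = \<lceil>(1 + \<bar>of_int T\<bar>) * (\<bar>R\<bar> / h + \<bar>R\<bar>)\<rceil>"
  have "points R \<subseteq> (\<lambda>(j, k). of_int j + of_int k * \<omega>) ` ({-B..B} \<times> {-B..B})"
  proof
    fix z assume "z \<in> points R"
    then obtain j k where z: "z = of_int j + of_int k * \<omega>" and R: "cmod z \<le> R"
      by (auto simp: points_def \<Lambda>_def)
    have "\<bar>of_int k\<bar> * h = \<bar>Im z\<bar>" using h_pos by (simp add: z \<omega>_def abs_mult)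
    also have "\<dots> \<le> \<bar>R\<bar>" using abs_Im_le_cmod[of z] R by simp
    finally have k: "\<bar>of_int k\<bar> \<le> \<bar>R\<bar> / h" using h_pos by (simp add: field_simps)
    have "\<bar>of_int j\<bar> \<le> \<bar>Re z\<bar> + \<bar>of_int k * (of_int T / 2)\<bar>" by (simp add: z \<omega>_def)
    also have "\<bar>Re z\<bar> \<le> \<bar>R\<bar>" using abs_Re_le_cmod[of z] R by simp
    also have "\<bar>of_int k * (of_int T / 2)\<bar> \<le> (\<bar>R\<bar> / h) * \<bar>of_int T :: real\<bar>"
      unfolding abs_mult using k by (intro mult_mono) auto
    finally have j: "\<bar>of_int j\<bar> \<le> \<bar>R\<bar> + (\<bar>R\<bar> / h) * \<bar>of_int T\<bar>" by simp
    have "\<bar>R\<bar> + (\<bar>R\<bar> / h) * \<bar>of_int T\<bar> \<le> (1 + \<bar>of_int T\<bar>) * (\<bar>R\<bar> / h + \<bar>R\<bar>)"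
         "\<bar>R\<bar> / h \<le> (1 + \<bar>of_int T\<bar>) * (\<bar>R\<bar> / h + \<bar>R\<bar>)"
      using h_pos by (simp_all add: distrib_left distrib_right mult.commute add_divide_distrib)
    hence "\<bar>of_int j\<bar> \<le> (of_int B :: real)" "\<bar>of_int k\<bar> \<le> (of_int B :: real)"
      using j k unfolding B_def by linarith+
    hence "\<bar>j\<bar> \<le> B" "\<bar>k\<bar> \<le> B" by linarith+
    thus "z \<in> (\<lambda>(j, k). of_int j + of_int k * \<omega>) ` ({-B..B} \<times> {-B..B})"
      by (auto simp: z intro!: image_eqI[of _ _ "(j, k)"])
  qed
  thus ?thesis by (rule finite_subset) auto
qed

section \<open>Counting lattice points in discs by area\<close>

lemma half_cell_cmod_le:
  assumes "\<bar>Re z\<bar> \<le> 1/2" "\<bar>Im z\<bar> \<le> h/2"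
  shows "cmod z \<le> d"
proof -
  have "(Re z)\<^sup>2 \<le> (1/2)\<^sup>2" "(Im z)\<^sup>2 \<le> (h/2)\<^sup>2"
    using assms by (auto intro: power2_le_iff_abs_le[THEN iffD2] simp: h_pos less_imp_le
        simp flip: abs_le_square_iff)
  hence "(cmod z)\<^sup>2 \<le> d\<^sup>2" by (simp add: cmod_power2 d_def power_divide)
  thus ?thesis by (rule power2_le_imp_le) (simp add: d_def)
qed

abbreviation corner :: complex where "corner \<equiv> Complex (1/2) (h/2)"

lemma in_cell: "x \<in> cbox (z - corner) (z + corner) \<longleftrightarrow> \<bar>Re (x - z)\<bar> \<le> 1/2 \<and> \<bar>Im (x - z)\<bar> \<le> h/2"
  "x \<in> box (z - corner) (z + corner) \<longleftrightarrow> \<bar>Re (x - z)\<bar> < 1/2 \<and> \<bar>Im (x - z)\<bar> < h/2"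
  unfolding in_cbox_complex_iff in_box_complex_iff minus_complex.sel plus_complex.sel complex.sel
    atLeastAtMost_iff greaterThanLessThan_iff
  by (intro iffI conjI; linarith)+

lemma content_cell:
  "measure lborel (cbox (z - corner) (z + corner)) = h"
  "measure lborel (box (z - corner) (z + corner)) = h"
  using h_pos by (simp_all add: measure_lborel_cbox_eq measure_lborel_box_eq Basis_complex_def inner_complex_def)

lemma content_disc:
  assumes "R \<ge> 0" shows "measure lborel (cball (0::complex) R) = pi * R\<^sup>2"
  using assms by (simp add: content_cball unit_ball_vol_2)

text \<open>The closed tiles around the points of the disc of radius \<open>R\<close> cover the disc
  of radius \<open>R - d\<close>, because every point of the plane lies in the tile of some lattice
  point at distance at most \<open>d\<close>.\<close>

lemma card_points_ge:
  assumes "d \<le> R"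
  shows "pi * (R - d)\<^sup>2 \<le> h * card (points R)"
proof -
  let ?C = "\<Union>z\<in>points R. cbox (z - corner) (z + corner)"
  have "cball 0 (R - d) \<subseteq> ?C"
  proof
    fix x :: complex assume x: "x \<in> cball 0 (R - d)"
    \<comment> \<open>Rounding the imaginary part selects the nearest row. That row is shifted
      horizontally by \<open>k T / 2\<close>, so the shift is removed before rounding the real
      part.\<close>
    define k where "k = round (Im x / h)"
    define j where "j = round (Re x - of_int k * of_int T / 2)"
    define z where "z = of_int j + of_int k * \<omega>"
    have "\<bar>Re (x - z)\<bar> = \<bar>of_int j - (Re x - of_int k * of_int T / 2)\<bar>"
      by (simp add: z_def \<omega>_def)
    hence 1: "\<bar>Re (x - z)\<bar> \<le> 1/2" unfolding j_def using of_int_round_abs_le by metis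
    have "\<bar>Im (x - z)\<bar> = h * \<bar>of_int k - Im x / h\<bar>"
      using h_pos by (simp add: z_def \<omega>_def abs_if field_simps)
    also have "\<dots> \<le> h * (1/2)"
      using h_pos of_int_round_abs_le[of "Im x / h"] unfolding k_def by (intro mult_left_mono) auto
    finally have 2: "\<bar>Im (x - z)\<bar> \<le> h/2" by simp
    have "cmod z \<le> cmod x + cmod (x - z)" by (metis norm_triangle_sub norm_minus_commute)
    also have "\<dots> \<le> R" using half_cell_cmod_le[OF 1 2] x by simp
    finally have "z \<in> points R" by (auto simp: points_def z_def intro: lattice_memI)
    thus "x \<in> ?C" using 1 2 in_cell(1)[of x z] by blast
  qed
  hence "measure lborel (cball (0::complex) (R - d)) \<le> measure lborel ?C"
    by (intro measure_mono_fmeasurable) (auto intro!: fmeasurable.finite_UN finite_points simp: fmeasurable_compact)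
  also have "\<dots> \<le> (\<Sum>z\<in>points R. measure lborel (cbox (z - corner) (z + corner)))"
    by (intro measure_UNION_le finite_points) auto
  also have "\<dots> = h * card (points R)" by (simp add: content_cell)
  finally show ?thesis using assms by (simp add: content_disc)
qed

text \<open>A difference of lattice points with imaginary part below \<open>h\<close> lies in the
  row \<open>k = 0\<close>, where distinct points are at least 1 apart. This makes the open tiles
  disjoint.\<close>

lemma lattice_separated:
  assumes "z \<in> \<Lambda>" "w \<in> \<Lambda>" "\<bar>Re (z - w)\<bar> < 1" "\<bar>Im (z - w)\<bar> < h"
  shows "z = w"
proof -
  obtain j k where zw: "z - w = of_int j + of_int k * \<omega>"
    using lattice_diff[OF assms(1,2)] by (auto simp: \<Lambda>_def)
  have "\<bar>of_int k\<bar> * h < 1 * h" using assms(4) h_pos unfolding zw by (simp add: \<omega>_def abs_mult)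
  hence "\<bar>of_int k :: real\<bar> < 1" using h_pos by (simp only: mult_less_cancel_right_pos)
  hence "k = 0" by linarith
  moreover from this have "j = 0" using assms(3) unfolding zw by simp
  ultimately show ?thesis using zw by simp
qed

text \<open>The open tiles around the points of the disc of radius \<open>R\<close> are pairwise
  disjoint and stay inside the disc of radius \<open>R + d\<close>.\<close>

lemma card_points_le:
  assumes "0 \<le> R"
  shows "h * card (points R) \<le> pi * (R + d)\<^sup>2"
proof -
  let ?C = "\<Union>z\<in>points R. box (z - corner) (z + corner)"
  have disj: "pairwise (\<lambda>z w. disjnt (box (z - corner) (z + corner)) (box (w - corner) (w + corner))) (points R)"
  proof (rule pairwiseI)
    fix z w assume zw: "z \<in> points R" "w \<in> points R" "z \<noteq> w"
    have False if "x \<in> box (z - corner) (z + corner)" "x \<in> box (w - corner) (w + corner)" for x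
    proof -
      have "\<bar>Re (x - z)\<bar> < 1/2" "\<bar>Im (x - z)\<bar> < h/2" "\<bar>Re (x - w)\<bar> < 1/2" "\<bar>Im (x - w)\<bar> < h/2"
        using that by (auto simp only: in_cell)
      hence "\<bar>Re (z - w)\<bar> < 1" "\<bar>Im (z - w)\<bar> < h"
        unfolding minus_complex.sel by linarith+
      thus False using lattice_separated zw by (auto simp: points_def)
    qed
    thus "disjnt (box (z - corner) (z + corner)) (box (w - corner) (w + corner))"
      by (auto simp: disjnt_iff)
  qed
  have d: "d \<ge> 0" by (simp add: d_def)
  have "h * card (points R) = (\<Sum>z\<in>points R. measure lborel (box (z - corner) (z + corner)))"
    by (simp add: content_cell)
  also have "\<dots> = measure lborel ?C"
    using disj by (intro measure_UNION'[symmetric] finite_points) (auto simp: fmeasurable_def emeasure_lborel_box_eq)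
  also have "\<dots> \<le> measure lborel (cball (0::complex) (R + d))"
  proof (intro measure_mono_fmeasurable subsetI)
    fix x assume "x \<in> ?C"
    then obtain z where z: "z \<in> points R" "\<bar>Re (x - z)\<bar> < 1/2" "\<bar>Im (x - z)\<bar> < h/2"
      by (auto simp only: in_cell UN_iff)
    hence "cmod (x - z) \<le> d" by (intro half_cell_cmod_le) auto
    thus "x \<in> cball 0 (R + d)"
      using z(1) norm_triangle_sub[of x z] by (auto simp: points_def)
  qed (auto simp: fmeasurable_compact finite_points)
  also have "\<dots> = pi * (R + d)\<^sup>2" using assms d by (simp add: content_disc)
  finally show ?thesis .
qed

subsection \<open>The pigeonhole argument\<close>

text \<open>Box principle: by the triangle inequality, tuples from the disc of radius
  \<open>r\<close> have their \<open>m\<close>-th value in the disc of radius \<open>A_m r\<close>.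
  Two tuples with equal values exist by the count, and their difference is a solution of size at
  most \<open>2 * r\<close>.\<close>

lemma siegel_pigeonhole:
  fixes M N :: nat
  assumes a: "\<forall>m\<in>{1..M}. \<forall>n\<in>{1..N}. a m n \<in> \<Lambda>"
    and card: "(\<Prod>m=1..M. card (points (coeff_norm N (a m) * r))) < card (points r) ^ N"
  shows "\<exists>z. (\<forall>n\<in>{1..N}. z n \<in> \<Lambda> \<and> cmod (z n) \<le> 2 * r) \<and> (\<exists>n\<in>{1..N}. z n \<noteq> 0) \<and>
             (\<forall>m\<in>{1..M}. linear_form N (a m) z = 0)"
proof -
  \<comment> \<open>Extensional functions are \<open>undefined\<close> off \<open>{1..N}\<close>, so
    \<open>F\<close> can be counted and two distinct members differ at an index in
    \<open>{1..N}\<close>.\<close>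
  define F where "F = ({1..N} \<rightarrow>\<^sub>E points r)"
  define G where "G = (\<Pi>\<^sub>E m\<in>{1..M}. points (coeff_norm N (a m) * r))"
  define f where "f = (\<lambda>z. \<lambda>m\<in>{1..M}. linear_form N (a m) z)"
  have "f ` F \<subseteq> G"
  proof (intro image_subsetI)
    fix z assume z: "z \<in> F"
    hence zn: "z n \<in> \<Lambda>" "cmod (z n) \<le> r" if "n \<in> {1..N}" for n
      using that by (auto simp: F_def points_def PiE_iff)
    have "linear_form N (a m) z \<in> points (coeff_norm N (a m) * r)" if m: "m \<in> {1..M}" for m
    proof -
      have "cmod (linear_form N (a m) z) \<le> (\<Sum>n=1..N. cmod (a m n) * r)"
        unfolding linear_form_def using zn
        by (intro sum_norm_le) (auto simp: norm_mult intro!: mult_left_mono)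
      moreover have "linear_form N (a m) z \<in> \<Lambda>"
        unfolding linear_form_def using zn a m by (intro lattice_sum lattice_mult) auto
      ultimately show ?thesis by (simp add: points_def coeff_norm_def sum_distrib_right)
    qed
    thus "f z \<in> G" by (auto simp: f_def G_def)
  qed
  moreover have "finite G" unfolding G_def by (intro finite_PiE finite_points finite_atLeastAtMost)
  ultimately have "card (f ` F) \<le> card G" by (intro card_mono)
  also have "card G = (\<Prod>m=1..M. card (points (coeff_norm N (a m) * r)))"
    unfolding G_def by (rule card_PiE) simp
  also have "\<dots> < card F" using card by (simp add: F_def card_PiE)
  finally obtain z w where zw: "z \<in> F" "w \<in> F" "f z = f w" "z \<noteq> w"
    using pigeonhole[of f F] unfolding inj_on_def by blast
  have "\<exists>n\<in>{1..N}. z n - w n \<noteq> 0"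
    using PiE_ext[of z "{1..N}" "\<lambda>_. points r" w] zw by (auto simp: F_def)
  moreover have "z n - w n \<in> \<Lambda> \<and> cmod (z n - w n) \<le> 2 * r" if "n \<in> {1..N}" for n
  proof -
    have "z n \<in> points r" "w n \<in> points r" using zw that by (auto simp: F_def)
    thus ?thesis using norm_triangle_ineq4[of "z n" "w n"]
      by (auto simp: points_def intro: lattice_diff)
  qed
  moreover have "linear_form N (a m) (\<lambda>n. z n - w n) = 0" if "m \<in> {1..M}" for m
    using fun_cong[OF zw(3), of m] that
    by (simp add: f_def linear_form_def algebra_simps sum_subtractf)
  ultimately show ?thesis by (intro exI[of _ "\<lambda>n. z n - w n"]) blast
qed

text \<open>The box principle is applied with \<open>r = X / 2\<close>. The bound
  \<open>8 * d \<le> X\<close> controls the boundary error in both counts, and the second bound on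
  \<open>X\<close> makes the tuples outnumber the possible values.\<close>

lemma siegel:
  fixes X :: real
  assumes MN: "M < N" and a: "\<forall>m\<in>{1..M}. \<forall>n\<in>{1..N}. a m n \<in> \<Lambda>"
    and nontriv: "\<forall>m\<in>{1..M}. \<exists>z. linear_form N (a m) z \<noteq> 0"
    and X: "8 * d \<le> X"
      "sqrt (8 * h / pi) * t_const powr (real M / (real N - real M)) *
         (\<Prod>m=1..M. coeff_norm N (a m)) powr (1 / (real N - real M)) \<le> X"
  shows "\<exists>z. (\<forall>n\<in>{1..N}. z n \<in> \<Lambda> \<and> cmod (z n) \<le> X) \<and> (\<exists>n\<in>{1..N}. z n \<noteq> 0) \<and>
             (\<forall>m\<in>{1..M}. linear_form N (a m) z = 0)"
proof -
  define A where "A m = coeff_norm N (a m)" for m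
  define P where "P = (\<Prod>m=1..M. A m)"
  \<comment> \<open>\<open>Y = (X / s)\<^sup>2\<close>, half the area heuristic for the number of lattice points in the disc of radius \<open>X / 2\<close>\<close>
  define Y where "Y = pi * X\<^sup>2 / (8 * h)"
  define q where "q = N - M"
  have q: "q > 0" "real N - real M = real q" "N = q + M" using MN by (auto simp: q_def)
  \<comment> \<open>A non-trivial form has a nonzero coefficient, whose absolute value is already at
    least 1.\<close>
  have A: "A m \<ge> 1" if m: "m \<in> {1..M}" for m
  proof -
    obtain z where "linear_form N (a m) z \<noteq> 0" using nontriv m by blast
    then obtain i where i: "i \<in> {1..N}" "a m i \<noteq> 0"
      unfolding linear_form_def by (metis (no_types, lifting) mult_zero_left sum.neutral)
    hence "1 \<le> cmod (a m i)" using a m by (intro lattice_cmod_ge_1) auto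
    also have "\<dots> \<le> A m" unfolding A_def coeff_norm_def using i by (intro member_le_sum) auto
    finally show ?thesis .
  qed
  have P: "P \<ge> 1" unfolding P_def using A by (intro prod_ge_1) auto
  have d: "d > 0" by (simp add: d_def add_pos_nonneg)
  hence X0: "X > 0" using X(1) by linarith
  hence Y: "Y > 0" using h_pos by (simp add: Y_def)

  have K: "Y < card (points (X / 2))"
  proof -
    \<comment> \<open>Since \<open>d \<le> X / 8\<close>, the reduced radius is at least
      \<open>3 * X / 8\<close>; strictness comes from \<open>9 / 64 > 1 / 8\<close>.\<close>
    have "(3 * X / 8)\<^sup>2 \<le> (X / 2 - d)\<^sup>2" using X(1) X0 by (intro power_mono) auto
    hence "pi * (3 * X / 8)\<^sup>2 \<le> pi * (X / 2 - d)\<^sup>2" by (intro mult_left_mono) auto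
    also have "\<dots> \<le> h * card (points (X / 2))" using X(1) d by (intro card_points_ge) linarith
    finally have "pi * (X\<^sup>2 * 9) / 64 \<le> h * card (points (X / 2))" by (simp add: power2_eq_square)
    moreover have "pi * X\<^sup>2 > 0" using X0 by simp
    ultimately have "pi * X\<^sup>2 / 8 < h * card (points (X / 2))" by linarith
    thus ?thesis using h_pos by (simp add: Y_def field_simps)
  qed

  have C: "card (points (A m * (X / 2))) \<le> 25 / 8 * (A m)\<^sup>2 * Y" if m: "m \<in> {1..M}" for m
  proof -
    \<comment> \<open>Because \<open>A m \<ge> 1\<close>, also \<open>d \<le> A m * X / 8\<close>,
      so the enlarged radius is at most \<open>5 * (A m * X) / 8\<close>. Its square carries
      \<open>25 / 64 = 25 / 8 * 1 / 8\<close>, and \<open>25 / 8\<close> is the square of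
      \<open>t_const\<close>.\<close>
    have "1 * X \<le> A m * X" using A[OF m] X0 by (intro mult_right_mono) auto
    hence "d \<le> A m * X / 8" using X(1) by linarith
    hence "(A m * (X / 2) + d)\<^sup>2 \<le> (5 * (A m * X) / 8)\<^sup>2"
      using A[OF m] X0 d by (intro power_mono) (auto simp: mult.commute)
    hence "pi * (A m * (X / 2) + d)\<^sup>2 \<le> pi * (5 * (A m * X) / 8)\<^sup>2" by (intro mult_left_mono) auto
    moreover have "h * card (points (A m * (X / 2))) \<le> pi * (A m * (X / 2) + d)\<^sup>2"
      using A[OF m] X0 by (intro card_points_le) auto
    ultimately have "h * card (points (A m * (X / 2))) \<le> pi * (5 * (A m * X) / 8)\<^sup>2" by linarith
    thus ?thesis using h_pos by (simp add: Y_def field_simps power2_eq_square)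
  qed

  \<comment> \<open>The second lower bound for \<open>X\<close> without the factor
    \<open>sqrt (8 * h / pi)\<close>. Its \<open>q\<close>-th power is free of roots.\<close>
  define u where "u = t_const powr (real M / real q) * P powr (1 / real q)"
  have t: "t_const > 0" "t_const\<^sup>2 = 25 / 8" by (auto simp: t_const_def power_divide power_mult_distrib)
  have u0: "u > 0" using t P by (simp add: u_def)
  have uq: "u ^ q = t_const ^ M * P"
    using t P q by (simp add: u_def power_mult_distrib powr_power powr_realpow)
  have "(25 / 8) ^ M * P\<^sup>2 \<le> Y ^ q"
  proof -
    have "sqrt (8 * h / pi) * u \<le> X" using X(2) by (simp add: u_def P_def A_def q mult.assoc)
    hence "(sqrt (8 * h / pi) * u)\<^sup>2 \<le> X\<^sup>2" using u0 h_pos by (intro power_mono) auto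
    hence "u\<^sup>2 \<le> Y" using h_pos by (simp add: Y_def power_mult_distrib field_simps)
    hence "(u\<^sup>2) ^ q \<le> Y ^ q" by (intro power_mono) auto
    also have "(u\<^sup>2) ^ q = (t_const\<^sup>2) ^ M * P\<^sup>2"
    proof -
      have "(u\<^sup>2) ^ q = (u ^ q)\<^sup>2" by (simp flip: power_mult add: mult.commute)
      thus ?thesis unfolding uq by (simp add: power_mult_distrib flip: power_mult add: mult.commute)
    qed
    finally show ?thesis by (simp add: t)
  qed
  \<comment> \<open>The factor \<open>Y ^ M\<close>, one \<open>Y\<close> for each form, turns the
    exponent \<open>q\<close> into \<open>q + M = N\<close>, the number of variables.\<close>
  hence main: "(25 / 8) ^ M * P\<^sup>2 * Y ^ M \<le> Y ^ N"
    using Y unfolding q(3) power_add by (intro mult_right_mono) auto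

  have "real (\<Prod>m=1..M. card (points (A m * (X / 2)))) \<le> (\<Prod>m=1..M. 25 / 8 * (A m)\<^sup>2 * Y)"
    unfolding of_nat_prod using C by (intro prod_mono) auto
  also have "\<dots> = (25 / 8) ^ M * P\<^sup>2 * Y ^ M"
    unfolding prod.distrib P_def prod_power_distrib by simp
  also note main
  also have "Y ^ N < real (card (points (X / 2))) ^ N"
    using K Y MN by (intro power_strict_mono) auto
  finally have "(\<Prod>m=1..M. card (points (A m * (X / 2)))) < card (points (X / 2)) ^ N"
    unfolding of_nat_power[symmetric] of_nat_less_iff .
  from siegel_pigeonhole[OF a this[unfolded A_def]] show ?thesis by simp
qed

end

subsection \<open>Rings of integers of imaginary quadratic fields\<close>

lemma complex_of_rat_eq: "(of_rat x :: complex) = of_real (of_rat x)"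
  by (cases x) (simp add: of_rat_rat)

lemma imag_quad_field_iff:
  "z \<in> imag_quad_field D \<longleftrightarrow> (\<exists>x y. Re z = of_rat x \<and> Im z = of_rat y * sqrt (real D))"
  unfolding imag_quad_field_def csqrt_minus_of_nat complex_of_rat_eq
  by (auto simp: complex_eq_iff)

text \<open>Integrality of trace and norm makes \<open>p = 2 Re z\<close> an integer and
  \<open>p^2 + D (2 y)^2\<close> four times the integer norm. As \<open>D\<close> is squarefree,
  \<open>q = 2 y\<close> is then an integer too.\<close>

lemma ring_of_ints_half_integers:
  assumes D: "squarefree D" and z: "z \<in> ring_of_ints (imag_quad_field D)"
  obtains p q :: int where "Re z = of_int p / 2" "Im z = of_int q / 2 * sqrt (real D)"
    "4 dvd p\<^sup>2 + int D * q\<^sup>2"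
proof -
  from z have alg: "algebraic_int z" and "z \<in> imag_quad_field D" by (auto simp: ring_of_ints_def)
  then obtain x y where x: "Re z = of_rat x" and y: "Im z = of_rat y * sqrt (real D)"
    unfolding imag_quad_field_iff by blast
  have norm: "(cmod z)\<^sup>2 = of_rat (x\<^sup>2 + of_nat D * y\<^sup>2)"
    by (simp add: cmod_power2 x y power_mult_distrib of_rat_add of_rat_mult of_rat_power)
  have "2 * Re z \<in> \<int> \<and> (cmod z)\<^sup>2 \<in> \<int>"
  proof (cases "Im z = 0")
    case False
    have "2 * Re z = of_rat (2 * x)" by (simp add: x of_rat_mult)
    hence "2 * Re z \<in> \<rat>" "(cmod z)\<^sup>2 \<in> \<rat>" unfolding norm by (metis Rats_of_rat)+
    with quadratic_algebraic_int_trace_norm[OF alg] False show ?thesis by blast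
  next
    case True
    \<comment> \<open>A real element of the field is rational, and a rational algebraic integer is
      an integer.\<close>
    hence "z = of_rat x" using x by (simp add: complex_eq_iff complex_of_rat_eq)
    hence "z \<in> \<int>" using rational_algebraic_int_is_int[OF alg] by simp
    then obtain i where "z = of_int i" by (elim Ints_cases)
    thus ?thesis by simp
  qed
  then obtain p m where p: "2 * Re z = of_int p" and m: "(cmod z)\<^sup>2 = of_int m"
    by (elim conjE Ints_cases)
  have "(of_rat (2 * x) :: real) = of_rat (of_int p)" using p x by (simp add: of_rat_mult)
  hence x2: "2 * x = of_int p" by (simp only: of_rat_eq_iff)
  have "(of_rat (x\<^sup>2 + of_nat D * y\<^sup>2) :: real) = of_rat (of_int m)" using m norm by simp
  hence "x\<^sup>2 + of_nat D * y\<^sup>2 = of_int m" by (simp only: of_rat_eq_iff)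
  hence *: "(2 * x)\<^sup>2 + of_nat D * (2 * y)\<^sup>2 = of_int (4 * m)"
    by (simp add: power_mult_distrib)
  hence "of_nat D * (2 * y)\<^sup>2 = of_int (4 * m - p\<^sup>2)" unfolding x2 by simp
  hence "2 * y \<in> \<int>" using squarefree_mult_rat_square_int[OF D] by (metis Ints_of_int)
  then obtain q where q: "2 * y = of_int q" by (elim Ints_cases)
  have "(of_int (p\<^sup>2 + int D * q\<^sup>2) :: rat) = of_int (4 * m)"
    using * unfolding x2 q by simp
  hence "p\<^sup>2 + int D * q\<^sup>2 = 4 * m" by (simp only: of_int_eq_iff)
  hence dvd: "4 dvd p\<^sup>2 + int D * q\<^sup>2" by simp
  have y': "y = of_int q / 2" using q by simp
  have "Im z = of_int q / 2 * sqrt (real D)" unfolding y y' by (simp add: of_rat_divide)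
  with p dvd show ?thesis by (intro that) auto
qed

text \<open>Here \<open>\<omega>\<close> is \<open>\<i>\<close> times the square root of
  \<open>D\<close>, a root of \<open>X^2 + D\<close>; the parity lemma removes both halves.\<close>

lemma ring_of_ints_mod_4_1_2:
  assumes D: "squarefree D" "D mod 4 = 1 \<or> D mod 4 = 2"
  shows "ring_of_ints (imag_quad_field D) = quadratic_lattice.\<Lambda> 0 (int D)"
proof -
  interpret quadratic_lattice 0 "int D" by unfold_locales (use D in \<open>auto intro: gr0I\<close>)
  have h: "h = sqrt (real D)" by (simp add: h_def)
  show ?thesis
  proof (intro set_eqI iffI)
    fix z assume "z \<in> ring_of_ints (imag_quad_field D)"
    then obtain p q where z: "Re z = of_int p / 2" "Im z = of_int q / 2 * sqrt (real D)"
      "4 dvd p\<^sup>2 + int D * q\<^sup>2" using ring_of_ints_half_integers[OF D(1)] by blast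
    with four_dvd_sum_squares_parity(1)[OF z(3) D(2)] obtain j k where "p = 2 * j" "q = 2 * k"
      by (auto elim!: evenE)
    thus "z \<in> \<Lambda>" using z
      by (intro lattice_memI[of _ j k]) (simp add: complex_eq_iff \<omega>_def h)
  next
    fix z assume z: "z \<in> \<Lambda>"
    then obtain j k where "z = of_int j + of_int k * \<omega>" by (auto simp: \<Lambda>_def)
    hence "z \<in> imag_quad_field D" unfolding imag_quad_field_iff
      by (intro exI[of _ "of_int j"] exI[of _ "of_int k"]) (simp add: \<omega>_def h)
    thus "z \<in> ring_of_ints (imag_quad_field D)"
      using lattice_algebraic_int[OF z] by (simp add: ring_of_ints_def)
  qed
qed

text \<open>The polynomial is \<open>X^2 - X + (D + 1) / 4\<close>, with discriminant
  \<open>-D\<close>; the division by 4 is exact in this residue class.\<close>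

lemma quadratic_lattice_mod_4_3:
  fixes D :: nat
  assumes "D mod 4 = 3"
  shows "quadratic_lattice 1 (int ((D + 1) div 4))"
    and "quadratic_lattice.h 1 (int ((D + 1) div 4)) = sqrt (real D) / 2"
proof -
  define n where "n = (D + 1) div 4"
  have D: "D + 1 = 4 * n" using assms unfolding n_def by presburger
  have "n > 0" using D by simp
  thus lat: "quadratic_lattice 1 (int ((D + 1) div 4))" unfolding n_def[symmetric] by unfold_locales simp
  have "of_int (int n) - (of_int 1)\<^sup>2 / 4 = real D / 4" using arg_cong[OF D, of real] by simp
  hence "sqrt (of_int (int n) - (of_int 1)\<^sup>2 / 4) = sqrt (real D) / 2"
    by (simp only: real_sqrt_divide real_sqrt_four)
  thus "quadratic_lattice.h 1 (int ((D + 1) div 4)) = sqrt (real D) / 2"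
    unfolding n_def[symmetric] quadratic_lattice.h_def[OF lat[folded n_def]] .
qed

text \<open>Now \<open>\<omega>\<close> has real part 1/2, so half-integral coordinates with
  \<open>p - q\<close> even are exactly \<open>j + q * \<omega>\<close> with
  \<open>j = (p - q) / 2\<close>.\<close>

lemma ring_of_ints_mod_4_3:
  assumes D: "squarefree D" "D mod 4 = 3"
  shows "ring_of_ints (imag_quad_field D) = quadratic_lattice.\<Lambda> 1 (int ((D + 1) div 4))"
proof -
  define c where "c = int ((D + 1) div 4)"
  interpret quadratic_lattice 1 c unfolding c_def by (rule quadratic_lattice_mod_4_3) fact
  have h: "h = sqrt (real D) / 2" unfolding c_def by (rule quadratic_lattice_mod_4_3) fact
  show ?thesis unfolding c_def[symmetric]
  proof (intro set_eqI iffI)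
    fix z assume "z \<in> ring_of_ints (imag_quad_field D)"
    then obtain p q where z: "Re z = of_int p / 2" "Im z = of_int q / 2 * sqrt (real D)"
      "4 dvd p\<^sup>2 + int D * q\<^sup>2" using ring_of_ints_half_integers[OF D(1)] by blast
    with four_dvd_sum_squares_parity(2)[OF z(3) D(2)] obtain j where "p - q = 2 * j"
      by (elim evenE)
    hence "p = 2 * j + q" by simp
    thus "z \<in> \<Lambda>" using z
      by (intro lattice_memI[of _ j q]) (simp add: complex_eq_iff \<omega>_def h add_divide_distrib)
  next
    fix z assume z: "z \<in> \<Lambda>"
    then obtain j k where "z = of_int j + of_int k * \<omega>" by (auto simp: \<Lambda>_def)
    hence "z \<in> imag_quad_field D" unfolding imag_quad_field_iff
      by (intro exI[of _ "of_int j + of_int k / 2"] exI[of _ "of_int k / 2"])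
         (simp add: \<omega>_def h of_rat_add of_rat_divide)
    thus "z \<in> ring_of_ints (imag_quad_field D)"
      using lattice_algebraic_int[OF z] by (simp add: ring_of_ints_def)
  qed
qed

text \<open>Common form of both residue classes: each has to supply only its lattice, the bound on
  \<open>d\<close> and the value of \<open>s\<close>.\<close>

lemma siegel_Max:
  assumes "quadratic_lattice T n"
    and "ring_of_ints K = quadratic_lattice.\<Lambda> T n"
    and "M < N"
    and "\<forall>m\<in>{1..M}. \<forall>n\<in>{1..N}. a m n \<in> ring_of_ints K"
    and "\<forall>m\<in>{1..M}. \<exists>z. linear_form N (a m) z \<noteq> 0"
    and "8 * quadratic_lattice.d T n \<le> B"
    and s: "s = sqrt (8 * quadratic_lattice.h T n / pi)"
  shows "\<exists>z :: nat \<Rightarrow> complex.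
      (\<forall>n\<in>{1..N}. z n \<in> ring_of_ints K) \<and>
      (\<exists>n\<in>{1..N}. z n \<noteq> 0) \<and>
      (\<forall>m\<in>{1..M}. linear_form N (a m) z = 0) \<and>
      1 \<le> Max ((\<lambda>n. cmod (z n)) ` {1..N}) \<and>
      Max ((\<lambda>n. cmod (z n)) ` {1..N}) \<le>
        max B (s * t_const powr (real M / (real N - real M)) *
             (\<Prod>m=1..M. coeff_norm N (a m)) powr (1 / (real N - real M)))"
    (is "\<exists>z. _ \<and> _ \<and> _ \<and> _ \<and> _ \<le> ?X")
proof -
  interpret quadratic_lattice T n by fact
  have "8 * d \<le> ?X" using assms(6) by simp
  from siegel[OF assms(3) assms(4)[unfolded assms(2)] assms(5) this] s
  obtain z where z: "\<forall>n\<in>{1..N}. z n \<in> \<Lambda> \<and> cmod (z n) \<le> ?X" "\<exists>n\<in>{1..N}. z n \<noteq> 0"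
    "\<forall>m\<in>{1..M}. linear_form N (a m) z = 0" by auto
  then obtain i where i: "i \<in> {1..N}" "z i \<noteq> 0" by blast
  have "1 \<le> cmod (z i)" using i z(1) by (intro lattice_cmod_ge_1) auto
  hence "1 \<le> Max ((\<lambda>n. cmod (z n)) ` {1..N})"
    using i(1) by (subst Max_ge_iff) auto
  moreover have "Max ((\<lambda>n. cmod (z n)) ` {1..N}) \<le> ?X"
    using z(1) i(1) by (subst Max_le_iff) auto
  ultimately show ?thesis using z assms(2) by (intro exI[of _ z]) auto
qed

theorem lemma3p2:
  fixes D M N :: nat and a :: "nat \<Rightarrow> nat \<Rightarrow> complex"
  assumes "D > 0" and "squarefree D"
    and "M < N"
    and "\<forall>m\<in>{1..M}. \<forall>n\<in>{1..N}. a m n \<in> ring_of_ints (imag_quad_field D)"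
    and "\<forall>m\<in>{1..M}. \<exists>z. linear_form N (a m) z \<noteq> 0"
  shows "\<exists>z :: nat \<Rightarrow> complex.
      (\<forall>n\<in>{1..N}. z n \<in> ring_of_ints (imag_quad_field D)) \<and>
      (\<exists>n\<in>{1..N}. z n \<noteq> 0) \<and>
      (\<forall>m\<in>{1..M}. linear_form N (a m) z = 0) \<and>
      1 \<le> Max ((\<lambda>n. cmod (z n)) ` {1..N}) \<and>
      Max ((\<lambda>n. cmod (z n)) ` {1..N}) \<le>
        max (2 * c_const D * sqrt (real D))
            (s_const D * t_const powr (real M / (real N - real M)) *
             (\<Prod>m=1..M. coeff_norm N (a m)) powr (1 / (real N - real M)))"
proof -
  have quarter: "real D powr (1/4) = sqrt (sqrt (real D))"
    by (simp add: powr_half_sqrt[symmetric] powr_powr)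
  have eight: "sqrt (8 :: real) = 2 * sqrt 2" using real_sqrt_mult[of 4 2] by simp
  show ?thesis
  proof (cases "D mod 4 = 1 \<or> D mod 4 = 2")
    case True
    interpret quadratic_lattice 0 "int D" by unfold_locales (use assms in simp)
    have h: "h = sqrt (real D)" by (simp add: h_def)
    \<comment> \<open>The estimate \<open>1 + D \<le> 2 * D\<close> is the source of
      \<open>c = 2 * sqrt 2\<close>: it gives
      \<open>8 * d \<le> 4 * sqrt 2 * sqrt D\<close>.\<close>
    have "sqrt (1 + real D) \<le> sqrt (2 * real D)" using assms(1) by (intro real_sqrt_le_mono) auto
    hence d: "8 * d \<le> 2 * c_const D * sqrt (real D)"
      using True by (simp add: d_def h c_const_def real_sqrt_mult)
    have "s_const D = sqrt (8 * h / pi)"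
      using True eight by (simp add: s_const_def h quarter real_sqrt_mult real_sqrt_divide)
    from siegel_Max[OF quadratic_lattice_axioms ring_of_ints_mod_4_1_2[OF assms(2) True]
        assms(3-5) d this] show ?thesis .
  next
    case False
    \<comment> \<open>Squarefreeness excludes the residue 0, so the last branch of the constants is
      the residue 3.\<close>
    have "\<not> 2\<^sup>2 dvd D" using squarefreeD[OF assms(2), of 2] by auto
    hence "D mod 4 \<noteq> 0" by (simp add: dvd_eq_mod_eq_0)
    moreover have "D mod 4 < 4" by simp
    ultimately have D3: "D mod 4 = 3" using False by linarith
    define c where "c = int ((D + 1) div 4)"
    interpret quadratic_lattice 1 c unfolding c_def by (rule quadratic_lattice_mod_4_3) fact
    have h: "h = sqrt (real D) / 2" unfolding c_def by (rule quadratic_lattice_mod_4_3) fact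
    have "D \<ge> 3" using D3 by presburger
    \<comment> \<open>With the flatter tile, \<open>1 + D / 4 \<le> D\<close> already gives
      \<open>8 * d \<le> 4 * sqrt D\<close>, hence \<open>c = 2\<close>.\<close>
    hence "sqrt (1 + real D / 4) \<le> sqrt (real D)" by (intro real_sqrt_le_mono) auto
    hence d: "8 * d \<le> 2 * c_const D * sqrt (real D)"
      using False unfolding d_def h by (simp add: c_const_def power_divide)
    have "s_const D = sqrt (8 * h / pi)"
      using False eight by (simp add: s_const_def h quarter real_sqrt_mult real_sqrt_divide)
    from siegel_Max[OF quadratic_lattice_axioms ring_of_ints_mod_4_3[OF assms(2) D3, folded c_def]
        assms(3-5) d this] show ?thesis .
  qed
qed

end
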